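(* Consider a bow diagram of affine type with at least one arrow $\bigcirc$ and with $n\ge2$ $x$-points $x_0,\dots,x_{n-1}$ (numbered anticlockwise, indices modulo $n$). If $N(x_i,x_{i+1})\ge0$ for every $i$, then the bow diagram can be transformed, by successive application of Hanany–Witten transitions, to a bow diagram with a cobalanced dimension vector, and the latter is unique among the bow diagrams obtained in this way.
   Context: **Bow diagram.** An anticlockwise oriented circle with finitely many marked points, each either an arrow (symbol $\bigcirc$, denoted $h$) or an $x$-point (symbol $\times$, denoted $x$), together with an integer (dimension) on each segment between consecutive marked points. Originally the dimensions are nonnegative; along the transitions the dimension on a segment may become negative (in which case the associated bow variety is understood to be empty). Marked points keep their names under transitions. For an $x$-point $x$, $N_x=v_{\zeta^-}-v_{\zeta^+}$, where $\zeta^-$, $\zeta^+$ are the segments just before and just after $x$ (anticlockwise). The dimension vector is *cobalanced* if $N_x=0$ for every $x$-point. Put $$N(x_i,x_{i+1})=N_{x_i}-N_{x_{i+1}}+\#\{\text{arrows on the anticlockwise arc from }x_i\text{ to }x_{i+1}\}.$$ **Hanany–Witten transition.** Replace consecutive pieces (in the anticlockwise direction) $l\,\bigcirc\,m\,\times\,k$ by $l\,\times\,m'\,\bigcirc\,k$ with $m'=l+k+1-m$ (the arrow and the $x$-point are exchanged, and the dimensions $l,k$ and the rest of the diagram are unchanged), or the inverse operation. *)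

theory Defs
  imports "HOL-Combinatorics.Combinatorics"
begin

(* A bow diagram of affine type with named marked points. The oriented circle is
   recorded by the map nxt sending a marked point to the following one in
   anticlockwise direction, so that no base point on the circle is chosen. The segment
   that starts at the marked point p is identified with p, and seg_dim p is its dimension. *)

record 'p bow_diagram =
  arrows :: "'p set"
  xpoints :: "'p set"
  nxt :: "'p \<Rightarrow> 'p"
  seg_dim :: "'p \<Rightarrow> int"

definition marked :: "'p bow_diagram \<Rightarrow> 'p set" where
  "marked D = arrows D \<union> xpoints D"

(* Outside the marked points nxt is the identity and seg_dim is 0, so that equality of
   records is equality of bow diagrams. Dimensions may be negative, as they can become
   so along Hanany-Witten transitions. *)

definition bow_diagram :: "'p bow_diagram \<Rightarrow> bool" where
  "bow_diagram D \<longleftrightarrow>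
     finite (arrows D) \<and> finite (xpoints D) \<and> arrows D \<inter> xpoints D = {} \<and>
     nxt D permutes marked D \<and> cyclic_on (nxt D) (marked D) \<and>
     (\<forall>p. p \<notin> marked D \<longrightarrow> seg_dim D p = 0)"

definition nonneg_dims :: "'p bow_diagram \<Rightarrow> bool" where
  "nonneg_dims D \<longleftrightarrow> (\<forall>p\<in>marked D. seg_dim D p \<ge> 0)"

definition prv :: "'p bow_diagram \<Rightarrow> 'p \<Rightarrow> 'p" where
  "prv D = inv (nxt D)"

definition N_at :: "'p bow_diagram \<Rightarrow> 'p \<Rightarrow> int" where
  "N_at D x = seg_dim D (prv D x) - seg_dim D x"

definition cobalanced :: "'p bow_diagram \<Rightarrow> bool" where
  "cobalanced D \<longleftrightarrow> (\<forall>x\<in>xpoints D. N_at D x = 0)"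

(* The marked points strictly between a and b on the anticlockwise arc from a to b. *)

definition arc :: "'p bow_diagram \<Rightarrow> 'p \<Rightarrow> 'p \<Rightarrow> 'p set" where
  "arc D a b = {(nxt D ^^ k) a | k. k > 0 \<and> (\<forall>j\<in>{1..k}. (nxt D ^^ j) a \<noteq> b)}"

definition N_between :: "'p bow_diagram \<Rightarrow> 'p \<Rightarrow> 'p \<Rightarrow> int" where
  "N_between D x y = N_at D x - N_at D y + int (card (arrows D \<inter> arc D x y))"

definition anticlockwise_numbering :: "'p bow_diagram \<Rightarrow> nat \<Rightarrow> (nat \<Rightarrow> 'p) \<Rightarrow> bool" where
  "anticlockwise_numbering D n x \<longleftrightarrow>
     bij_betw x {..<n} (xpoints D) \<and>
     (\<forall>i<n. xpoints D \<inter> arc D (x i) (x (Suc i mod n)) = {})"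

(* For consecutive p, h, x, q with dimensions l, m, k in between, the points h and x are
   exchanged: conjugating nxt by their transposition yields p, x, h, q. The new
   dimensions are l, l + k + 1 - m, k; the segments starting at x and at h are now the
   second and the third of these. *)

definition hw_swap :: "'p \<Rightarrow> 'p \<Rightarrow> 'p bow_diagram \<Rightarrow> 'p bow_diagram" where
  "hw_swap h x D =
     (let l = seg_dim D (prv D h); m = seg_dim D h; k = seg_dim D x
      in D\<lparr>nxt := transpose h x \<circ> nxt D \<circ> transpose h x,
           seg_dim := (seg_dim D)(x := l + k + 1 - m, h := k)\<rparr>)"

definition hw_move :: "'p bow_diagram \<Rightarrow> 'p bow_diagram \<Rightarrow> bool" where
  "hw_move D D' \<longleftrightarrow>
     (\<exists>h\<in>arrows D. \<exists>x\<in>xpoints D. nxt D h = x \<and> D' = hw_swap h x D)"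

definition hw_transition :: "'p bow_diagram \<Rightarrow> 'p bow_diagram \<Rightarrow> bool" where
  "hw_transition D D' \<longleftrightarrow> hw_move D D' \<or> hw_move D' D"

end

theory Submission
  imports Defs "HOL-Library.Confluence"
begin

text \<open>A move past an arrow lowers \<open>N_x\<close> by one for the moved \<open>x\<close>-point and fixes it for
the others, and moves of different \<open>x\<close>-points commute. So the moves are confluent, and two
diagrams that are reached from a common one and have the same numbers \<open>N_x\<close> coincide.
Reversing the orientation of the circle turns moves into inverse moves and changes the sign of
\<open>N_x\<close>. For existence, if \<open>N_x > 0\<close> and the point before \<open>x\<close> is an
\<open>x\<close>-point \<open>x'\<close>, then \<open>N(x', x) \<ge> 0\<close> gives \<open>N_x' > 0\<close>; hence
some \<open>x\<close>-point with positive \<open>N\<close> has an arrow before it and can be moved. The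
negative values are raised in the same way after reversing the orientation.\<close>

section \<open>Bow diagrams, predecessors and conjugation by a transposition\<close>

lemma bow_diagramD:
  assumes "bow_diagram D"
  shows "finite (arrows D)" "finite (xpoints D)" "arrows D \<inter> xpoints D = {}"
    "nxt D permutes marked D" "cyclic_on (nxt D) (marked D)"
    "\<And>p. p \<notin> marked D \<Longrightarrow> seg_dim D p = 0" "bij (nxt D)"
  using assms permutes_bij unfolding bow_diagram_def by blast+

lemma prv_nxt [simp]: "bow_diagram D \<Longrightarrow> prv D (nxt D p) = p"
  by (metis bow_diagramD(4) permutes_inverses(2) prv_def)

lemma nxt_prv [simp]: "bow_diagram D \<Longrightarrow> nxt D (prv D p) = p"
  by (metis bow_diagramD(4) permutes_inverses(1) prv_def)

lemma arrows_hw_swap [simp]: "arrows (hw_swap h x D) = arrows D"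
  and xpoints_hw_swap [simp]: "xpoints (hw_swap h x D) = xpoints D"
  and marked_hw_swap [simp]: "marked (hw_swap h x D) = marked D"
  by (simp_all add: hw_swap_def Let_def marked_def)

lemma nxt_hw_swap: "nxt (hw_swap h x D) = transpose h x \<circ> nxt D \<circ> transpose h x"
  by (simp add: hw_swap_def Let_def)

lemma nxt_hw_swap_funpow:
  "(nxt (hw_swap h x D) ^^ k) p = transpose h x ((nxt D ^^ k) (transpose h x p))"
  by (induction k) (simp_all add: nxt_hw_swap)

lemma seg_dim_hw_swap:
  "seg_dim (hw_swap h x D) =
    (seg_dim D)(x := seg_dim D (prv D h) + seg_dim D x + 1 - seg_dim D h, h := seg_dim D x)"
  by (simp add: hw_swap_def Let_def)

text \<open>A cycle conjugated by a transposition of two of its points is again a cycle on the same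
  set. The dimensions at marked points are left arbitrary, so the result serves for a move and for
  its inverse.\<close>

lemma bow_diagram_conj_transpose:
  assumes D: "bow_diagram D" and ab: "a \<in> marked D" "b \<in> marked D"
    and D': "arrows D' = arrows D" "xpoints D' = xpoints D"
      "nxt D' = transpose a b \<circ> nxt D \<circ> transpose a b"
      "\<And>p. p \<notin> marked D \<Longrightarrow> seg_dim D' p = seg_dim D p"
  shows "bow_diagram D'"
proof -
  have m: "marked D' = marked D"
    using D' by (simp add: marked_def)
  have "nxt D' permutes marked D"
    unfolding D'(3) comp_assoc
    by (intro permutes_compose permutes_swap_id ab bow_diagramD(4)[OF D])
  moreover have "cyclic_on (nxt D') (transpose a b ` marked D)"
    by (rule cyclic_on_image[OF bow_diagramD(5)[OF D]]) (simp add: D')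
  ultimately show ?thesis
    using bow_diagramD[OF D] D' ab m by (simp add: bow_diagram_def transpose_image_eq)
qed

section \<open>The effect of one move on dimensions and on \<open>N_at\<close>\<close>

locale hw_exchange =
  fixes D :: "'p bow_diagram" and h x :: 'p
  assumes bow: "bow_diagram D"
    and arrow: "h \<in> arrows D"
    and xpoint: "x \<in> xpoints D"
    and adjacent: "nxt D h = x"
begin

abbreviation D' :: "'p bow_diagram" where "D' \<equiv> hw_swap h x D"

lemma arrow_neq_xpoint: "y \<in> xpoints D \<Longrightarrow> h \<noteq> y"
  using arrow bow_diagramD(3)[OF bow] by auto

lemma neq [simp]: "h \<noteq> x" "x \<noteq> h"
  using arrow_neq_xpoint[OF xpoint] by auto

lemma marked_hx: "h \<in> marked D" "x \<in> marked D"
  using arrow xpoint by (auto simp: marked_def)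

lemma bow_swap: "bow_diagram D'"
  by (rule bow_diagram_conj_transpose[OF bow marked_hx])
    (use marked_hx in \<open>auto simp: nxt_hw_swap seg_dim_hw_swap\<close>)

lemma prv_swap: "prv D' p = transpose h x (prv D (transpose h x p))"
proof -
  have "nxt D' (transpose h x (prv D (transpose h x p))) = p"
    by (simp add: nxt_hw_swap bow)
  then show ?thesis
    by (metis bow_swap prv_nxt)
qed

lemma prv_x [simp]: "prv D x = h"
  using prv_nxt[OF bow, of h] adjacent by simp

lemma nxt_swap_x: "nxt D' x = h"
  by (simp add: nxt_hw_swap adjacent)

text \<open>The segment before \<open>q\<close> changes its name only if it started at
  \<open>x\<close>; afterwards it starts at \<open>h\<close>, which carries the old value at
  \<open>x\<close>.\<close>

lemma seg_prv_swap_other: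
  assumes "q \<noteq> h" "q \<noteq> x"
  shows "seg_dim D' (prv D' q) = seg_dim D (prv D q)"
proof -
  have "prv D q \<noteq> h"
    using assms adjacent nxt_prv[OF bow, of q] by auto
  then show ?thesis
    using assms by (cases "prv D q = x") (auto simp: prv_swap seg_dim_hw_swap)
qed

lemma seg_prv_swap_x: "seg_dim D' (prv D' x) = seg_dim D (prv D h)"
proof -
  have "prv D h \<noteq> h"
    using adjacent nxt_prv[OF bow, of h] by auto
  \<comment> \<open>The case \<open>prv D h = x\<close> is the circle with only two marked points,
    where the outer dimensions \<open>l\<close> and \<open>k\<close> belong to one segment.\<close>
  then show ?thesis
    by (cases "prv D h = x") (auto simp: prv_swap seg_dim_hw_swap)
qed

text \<open>The value \<open>m - k\<close> becomes \<open>l - (l + k + 1 - m)\<close>.\<close>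

lemma N_at_swap_x: "N_at D' x = N_at D x - 1"
  by (simp add: N_at_def seg_prv_swap_x) (simp add: seg_dim_hw_swap)

lemma N_at_swap_other: "y \<in> xpoints D \<Longrightarrow> y \<noteq> x \<Longrightarrow> N_at D' y = N_at D y"
  using arrow_neq_xpoint[of y]
  by (simp add: N_at_def seg_prv_swap_other) (simp add: seg_dim_hw_swap)

end

section \<open>Commutation and confluence of moves\<close>

text \<open>The label is the moved \<open>x\<close>-point alone, since the arrow can only be its
  predecessor; this makes the steps with a fixed label deterministic.\<close>

definition x_step :: "'p \<Rightarrow> 'p bow_diagram \<Rightarrow> 'p bow_diagram \<Rightarrow> bool" where
  "x_step x D D' \<longleftrightarrow> (\<exists>h. hw_exchange D h x \<and> D' = hw_swap h x D)"

definition bow_step :: "'p bow_diagram \<Rightarrow> 'p bow_diagram \<Rightarrow> bool" where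
  "bow_step D D' \<longleftrightarrow> (\<exists>x. x_step x D D')"

lemma x_stepD:
  assumes "x_step x D D'"
  shows "bow_diagram D" "bow_diagram D'" "x \<in> xpoints D" "arrows D' = arrows D"
    "xpoints D' = xpoints D" "N_at D' x = N_at D x - 1"
    "\<And>y. y \<in> xpoints D \<Longrightarrow> y \<noteq> x \<Longrightarrow> N_at D' y = N_at D y"
  using assms unfolding x_step_def
  by (auto simp: hw_exchange.bow hw_exchange.bow_swap hw_exchange.xpoint
      hw_exchange.N_at_swap_x hw_exchange.N_at_swap_other)

lemma x_step_N_at:
  assumes "x_step x D D'" "y \<in> xpoints D"
  shows "N_at D' y = N_at D y - (if y = x then 1 else 0)"
  using x_stepD(6,7)[OF assms(1)] assms(2) by auto

lemma bow_step_iff_hw_move: "bow_step D D' \<longleftrightarrow> bow_diagram D \<and> hw_move D D'"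
  by (auto simp: bow_step_def x_step_def hw_move_def hw_exchange_def)

lemma bow_stepE:
  assumes "bow_step D D'"
  obtains x where "x_step x D D'"
  using assms by (auto simp: bow_step_def)

text \<open>Transitions run in both directions, so well-formedness has to be pulled back along a
  move as well; conjugating once more by the same transposition undoes the change of
  \<open>nxt\<close>.\<close>

lemma hw_move_bow_diagram_iff:
  assumes "hw_move D D'"
  shows "bow_diagram D' \<longleftrightarrow> bow_diagram D"
proof
  assume "bow_diagram D"
  then show "bow_diagram D'"
    using assms by (meson bow_stepE bow_step_iff_hw_move x_stepD(2))
next
  assume D': "bow_diagram D'"
  from assms obtain h x where hx: "h \<in> arrows D" "x \<in> xpoints D" "D' = hw_swap h x D"
    by (auto simp: hw_move_def)
  show "bow_diagram D"
  proof (rule bow_diagram_conj_transpose[OF D', of h x])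
    show "nxt D = transpose h x \<circ> nxt D' \<circ> transpose h x"
      by (simp add: hx nxt_hw_swap fun_eq_iff)
  qed (use hx in \<open>auto simp: marked_def seg_dim_hw_swap\<close>)
qed

lemma x_step_deterministic: "x_step x D E \<Longrightarrow> x_step x D F \<Longrightarrow> E = F"
  unfolding x_step_def using hw_exchange.prv_x by metis

text \<open>The two exchanged pairs are disjoint, so their transpositions commute. If the pairs are
  adjacent on the circle, they share an outer segment, and its dimension is changed by neither
  move.\<close>

lemma x_step_commute:
  assumes "x_step x D E" "x_step y D F" "x \<noteq> y"
  obtains G where "x_step y E G" "x_step x F G"
proof -
  obtain h g where h: "hw_exchange D h x" "E = hw_swap h x D"
    and g: "hw_exchange D g y" "F = hw_swap g y D"
    using assms by (auto simp: x_step_def)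
  interpret h: hw_exchange D h x by (rule h)
  interpret g: hw_exchange D g y by (rule g)
  have hg: "h \<noteq> g" "g \<noteq> h" "h \<noteq> y" "y \<noteq> h" "x \<noteq> g" "g \<noteq> x" "y \<noteq> x"
    using assms(3) h.adjacent g.adjacent h.arrow_neq_xpoint[OF g.xpoint]
      g.arrow_neq_xpoint[OF h.xpoint] by auto
  have "hw_exchange E g y"
    unfolding h(2) using h.bow_swap g.arrow g.xpoint
    by unfold_locales (simp_all add: nxt_hw_swap g.adjacent hg assms(3))
  moreover have "hw_exchange F h x"
    unfolding g(2) using g.bow_swap h.arrow h.xpoint
    by unfold_locales (simp_all add: nxt_hw_swap h.adjacent hg assms(3))
  moreover have "hw_swap g y E = hw_swap h x F"
  proof (rule bow_diagram.equality)
    show "arrows (hw_swap g y E) = arrows (hw_swap h x F)"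
      "xpoints (hw_swap g y E) = xpoints (hw_swap h x F)"
      by (simp_all add: h g)
    have "transpose g y \<circ> transpose h x = transpose h x \<circ> transpose g y"
      using hg assms(3) by (auto simp: fun_eq_iff transpose_def)
    then show "nxt (hw_swap g y E) = nxt (hw_swap h x F)"
      unfolding h(2) g(2) nxt_hw_swap by (metis comp_assoc)
    have "seg_dim E (prv E g) = seg_dim D (prv D g)"
      unfolding h(2) by (rule h.seg_prv_swap_other) (use hg in auto)
    moreover have "seg_dim F (prv F h) = seg_dim D (prv D h)"
      unfolding g(2) by (rule g.seg_prv_swap_other) (use hg in auto)
    ultimately show "seg_dim (hw_swap g y E) = seg_dim (hw_swap h x F)"
      unfolding seg_dim_hw_swap[of g y E] seg_dim_hw_swap[of h x F]
      using hg assms(3) by (simp add: h(2) g(2) seg_dim_hw_swap fun_eq_iff)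
  qed simp
  ultimately show ?thesis
    using that unfolding x_step_def by metis
qed

lemma confluentp_bow_step: "confluentp bow_step"
proof (rule strong_confluentp_imp_confluentp, rule strong_confluentpI)
  fix D E F :: "'a bow_diagram"
  assume "bow_step D E" "bow_step D F"
  then obtain x y where xy: "x_step x D E" "x_step y D F"
    by (auto simp: bow_step_def)
  show "\<exists>u. bow_step\<^sup>*\<^sup>* E u \<and> bow_step\<^sup>=\<^sup>= F u"
  proof (cases "x = y")
    case True
    then have "E = F" using xy x_step_deterministic by metis
    then show ?thesis by blast
  next
    case False
    then obtain G where "x_step y E G" "x_step x F G"
      using x_step_commute xy by metis
    then show ?thesis unfolding bow_step_def by blast
  qed
qed

lemma bow_steps_mono:
  assumes "bow_step\<^sup>*\<^sup>* D E"
  shows "xpoints E = xpoints D \<and> arrows E = arrows D \<and> (\<forall>y\<in>xpoints D. N_at E y \<le> N_at D y)"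
  using assms
proof (induction rule: rtranclp_induct)
  case (step E F)
  then obtain x where x: "x_step x E F" by (elim bow_stepE)
  show ?case
    using step.IH x_step_N_at[OF x] x_stepD(4,5)[OF x] by force
qed simp

text \<open>Since \<open>N_at\<close> at \<open>x\<close> drops on the way to \<open>B\<close>, the
  point \<open>x\<close> is moved somewhere along the path, and commutation brings this step to the
  front.\<close>

lemma x_step_factor:
  assumes "bow_step\<^sup>*\<^sup>* D B" "x_step x D E" "N_at B x < N_at D x"
  shows "bow_step\<^sup>*\<^sup>* E B"
  using assms
proof (induction arbitrary: E rule: converse_rtranclp_induct)
  case (step D F)
  then obtain y where y: "x_step y D F" by (elim bow_stepE)
  show ?case
  proof (cases "x = y")
    case True
    then show ?thesis using x_step_deterministic step.prems(1) step.hyps(2) y by metis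
  next
    case False
    obtain G where G: "x_step y E G" "x_step x F G"
      using x_step_commute[OF step.prems(1) y False] by metis
    have "N_at F x = N_at D x"
      using x_step_N_at[OF y x_stepD(3)[OF step.prems(1)]] False by simp
    then have "bow_step\<^sup>*\<^sup>* G B" using step.IH[OF G(2)] step.prems(2) by simp
    then show ?thesis using G(1) by (meson bow_step_def converse_rtranclp_into_rtranclp)
  qed
qed simp

text \<open>The steps of the path to \<open>A\<close> are split off one by one from the path to
  \<open>B\<close>, which lowers each \<open>N_at\<close> at least as far.\<close>

lemma bow_steps_factor:
  assumes "bow_step\<^sup>*\<^sup>* D A" "bow_step\<^sup>*\<^sup>* D B" "\<And>y. y \<in> xpoints D \<Longrightarrow> N_at B y \<le> N_at A y"
  shows "bow_step\<^sup>*\<^sup>* A B"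
  using assms
proof (induction rule: converse_rtranclp_induct)
  case (step D E)
  then obtain x where x: "x_step x D E" by (elim bow_stepE)
  have "N_at B x < N_at D x"
    using step.prems(2)[OF x_stepD(3)[OF x]] bow_steps_mono[OF step.hyps(2)] x_stepD[OF x] by force
  then have "bow_step\<^sup>*\<^sup>* E B" using x_step_factor step.prems(1) x by metis
  then show ?case using step.IH step.prems(2) x_stepD(5)[OF x] by simp
qed

text \<open>Factoring gives a path from \<open>A\<close> to \<open>B\<close>; a first step on it
  would lower some \<open>N_at\<close> for good, so the path is empty.\<close>

lemma bow_steps_N_at_unique:
  assumes "bow_step\<^sup>*\<^sup>* D A" "bow_step\<^sup>*\<^sup>* D B" "\<And>y. y \<in> xpoints D \<Longrightarrow> N_at A y = N_at B y"
  shows "A = B"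
proof -
  have "bow_step\<^sup>*\<^sup>* A B" using bow_steps_factor[OF assms(1,2)] assms(3) by simp
  then show ?thesis
  proof (cases rule: converse_rtranclpE)
    case (step C)
    then obtain x where x: "x_step x A C" by (elim bow_stepE)
    have "x \<in> xpoints D" using x_stepD(3)[OF x] bow_steps_mono[OF assms(1)] by simp
    then show ?thesis
      using bow_steps_mono[OF step(2)] x_stepD[OF x] assms(3) by force
  qed simp
qed

section \<open>Reversal of the orientation\<close>

text \<open>A segment is named by its starting point, so after reversal the segment named
  \<open>p\<close> is the one that used to end at \<open>p\<close>.\<close>

definition mirror :: "'p bow_diagram \<Rightarrow> 'p bow_diagram" where
  "mirror D = D\<lparr>nxt := prv D, seg_dim := seg_dim D \<circ> prv D\<rparr>"

lemma mirror_simps [simp]: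
  "arrows (mirror D) = arrows D" "xpoints (mirror D) = xpoints D" "marked (mirror D) = marked D"
  "nxt (mirror D) = prv D" "seg_dim (mirror D) p = seg_dim D (prv D p)"
  by (simp_all add: mirror_def marked_def)

lemma prv_mirror: "bow_diagram D \<Longrightarrow> prv (mirror D) = nxt D"
  unfolding prv_def using permutes_inv_inv[OF bow_diagramD(4)] by (simp add: prv_def)

lemma mirror_mirror: "bow_diagram D \<Longrightarrow> mirror (mirror D) = D"
  by (rule bow_diagram.equality) (auto simp: prv_mirror)

lemma bow_diagram_mirror:
  assumes "bow_diagram D"
  shows "bow_diagram (mirror D)"
proof -
  note D = bow_diagramD[OF assms]
  have p: "prv D permutes marked D"
    unfolding prv_def using D(4) by (rule permutes_inv)
  have "permutation (nxt D)"
    using D(1,2,4) by (auto simp: permutation_permutes marked_def)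
  then have "cyclic_on (prv D) (marked D)"
    using D(5) by (simp add: cyclic_on_def prv_def orbit_inv_eq)
  moreover have "seg_dim D (prv D q) = 0" if "q \<notin> marked D" for q
    using D(6) that permutes_not_in[OF p that] by simp
  ultimately show ?thesis
    using D p by (simp add: bow_diagram_def)
qed

lemma N_at_mirror: "bow_diagram D \<Longrightarrow> N_at (mirror D) x = - N_at D x"
  by (simp add: N_at_def prv_mirror)

text \<open>Reversal exchanges \<open>l\<close> and \<open>k\<close>, and the rule
  \<open>m' = l + k + 1 - m\<close> is symmetric in them and an involution in
  \<open>m\<close>.\<close>

lemma x_step_mirror:
  assumes "x_step x D E"
  shows "x_step x (mirror E) (mirror D)"
proof -
  obtain h where h: "hw_exchange D h x" "E = hw_swap h x D"
    using assms by (auto simp: x_step_def)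
  interpret hw_exchange D h x by (rule h)
  have bE: "bow_diagram E" unfolding h(2) by (rule bow_swap)
  have pE: "prv E h = x" using prv_nxt[OF bE, of x] nxt_swap_x h(2) by simp
  have "hw_exchange (mirror E) h x"
    using bow_diagram_mirror[OF bE] arrow xpoint pE
    by unfold_locales (simp_all add: h(2))
  moreover have "mirror D = hw_swap h x (mirror E)"
  proof (rule bow_diagram.equality)
    show "nxt (mirror D) = nxt (hw_swap h x (mirror E))"
      by (simp add: nxt_hw_swap fun_eq_iff h(2) prv_swap)
    show "seg_dim (mirror D) = seg_dim (hw_swap h x (mirror E))"
    proof
      fix q
      show "seg_dim (mirror D) q = seg_dim (hw_swap h x (mirror E)) q"
        using seg_prv_swap_other[of q] seg_prv_swap_x pE
        by (simp add: seg_dim_hw_swap[of h x "mirror E"] prv_mirror[OF bE] bE h(2)[symmetric])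
           (auto simp: h(2) seg_dim_hw_swap)
    qed
  qed (simp_all add: h(2))
  ultimately show ?thesis by (auto simp: x_step_def)
qed

lemma bow_steps_mirror: "bow_step\<^sup>*\<^sup>* D E \<Longrightarrow> bow_step\<^sup>*\<^sup>* (mirror E) (mirror D)"
  by (induction rule: rtranclp_induct)
    (auto simp: bow_step_def intro: converse_rtranclp_into_rtranclp dest: x_step_mirror)

section \<open>The nonnegativity condition and its invariance\<close>

text \<open>Between consecutive \<open>x\<close>-points \<open>y\<close> and \<open>z = nxt^k y\<close> there are
\<open>k - 1\<close> arrows, so this is the condition \<open>N(y, z) \<ge> 0\<close>.\<close>

definition balanceable :: "'p bow_diagram \<Rightarrow> bool" where
  "balanceable D \<longleftrightarrow> (\<forall>y\<in>xpoints D. \<forall>k>0. (nxt D ^^ k) y \<in> xpoints D \<longrightarrow>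
     (\<forall>j\<in>{1..<k}. (nxt D ^^ j) y \<notin> xpoints D) \<longrightarrow>
     N_at D ((nxt D ^^ k) y) < N_at D y + int k)"

lemma balanceableD:
  assumes "balanceable D" "y \<in> xpoints D" "0 < k" "(nxt D ^^ k) y \<in> xpoints D"
    "\<And>j. 0 < j \<Longrightarrow> j < k \<Longrightarrow> (nxt D ^^ j) y \<notin> xpoints D"
  shows "N_at D ((nxt D ^^ k) y) < N_at D y + int k"
  using assms unfolding balanceable_def by auto

lemma balanceableI:
  assumes "\<And>y k. y \<in> xpoints D \<Longrightarrow> 0 < k \<Longrightarrow> (nxt D ^^ k) y \<in> xpoints D \<Longrightarrow>
      (\<And>j. 0 < j \<Longrightarrow> j < k \<Longrightarrow> (nxt D ^^ j) y \<notin> xpoints D) \<Longrightarrow>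
      N_at D ((nxt D ^^ k) y) < N_at D y + int k"
  shows "balanceable D"
  using assms unfolding balanceable_def by auto

text \<open>Passing the arrow removes one arrow from the gap before \<open>x\<close> and adds one to
  the gap after it, which exactly compensates the drop of \<open>N_at\<close> at
  \<open>x\<close>.\<close>

lemma (in hw_exchange) balanceable_swap:
  assumes D: "balanceable D"
  shows "balanceable D'"
proof (rule balanceableI)
  fix y k
  define z where "z = (nxt D' ^^ k) y"
  assume y: "y \<in> xpoints D'" and k: "0 < k" and z': "(nxt D' ^^ k) y \<in> xpoints D'"
    and free: "\<And>j. 0 < j \<Longrightarrow> j < k \<Longrightarrow> (nxt D' ^^ j) y \<notin> xpoints D'"
  have z: "z \<in> xpoints D" using z' by (simp add: z_def)
  have hz: "h \<noteq> z" using arrow_neq_xpoint z by auto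
  have "N_at D' z < N_at D' y + int k"
  proof (cases "y = x")
    case True
    \<comment> \<open>In the new diagram \<open>x\<close> stands where \<open>h\<close> stood, so a
      walk from \<open>x\<close> is one step behind the old one and the old gap is
      \<open>l = k - 1\<close>.\<close>
    have pow: "(nxt D' ^^ Suc j) x = transpose h x ((nxt D ^^ j) x)" for j
      unfolding nxt_hw_swap_funpow transpose_apply_second
      by (simp only: funpow_Suc_right o_apply adjacent)
    obtain l where l: "k = Suc l" using k by (cases k) auto
    show ?thesis
    proof (cases "z = x")
      case True
      then show ?thesis using \<open>y = x\<close> k by simp
    next
      case False
      have "transpose h x ((nxt D ^^ l) x) = z"
        using pow[of l] l \<open>y = x\<close> by (simp add: z_def)
      then have zl: "(nxt D ^^ l) x = z"
        using hz False by (auto simp: transpose_def split: if_splits)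
      have "N_at D ((nxt D ^^ l) x) < N_at D x + int l"
      proof (rule balanceableD[OF D xpoint])
        show "0 < l" using zl False by (cases l) auto
        show "(nxt D ^^ l) x \<in> xpoints D" using zl z by simp
        fix j assume j: "0 < j" "j < l"
        have 1: "transpose h x ((nxt D ^^ j) x) \<notin> xpoints D"
          using free[of "Suc j"] pow[of j] j l \<open>y = x\<close> by simp
        \<comment> \<open>The transposition would turn an early return to \<open>x\<close> into
          \<open>h\<close> and hide it from \<open>free\<close>; injectivity of the new
          \<open>nxt\<close> exposes it one step earlier.\<close>
        have "(nxt D ^^ j) x \<noteq> x"
        proof
          assume "(nxt D ^^ j) x = x"
          then have "nxt D' ((nxt D' ^^ j) x) = nxt D' x"
            using pow[of j] nxt_swap_x by simp
          then have "(nxt D' ^^ j) x = x"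
            by (metis bow_swap prv_nxt)
          then show False using free[of j] j l \<open>y = x\<close> xpoint by simp
        qed
        then show "(nxt D ^^ j) x \<notin> xpoints D"
          using 1 arrow_neq_xpoint by (auto simp: transpose_def split: if_splits)
      qed
      then show ?thesis
        using zl l \<open>y = x\<close> N_at_swap_x N_at_swap_other[OF z False] by simp
    qed
  next
    case False
    have y': "y \<in> xpoints D" using y by simp
    have hy: "h \<noteq> y" using arrow_neq_xpoint[OF y'] .
    have pow: "(nxt D' ^^ j) y = transpose h x ((nxt D ^^ j) y)" for j
      unfolding nxt_hw_swap_funpow using False hy by simp
    have noth: "(nxt D ^^ j) y \<noteq> h" if "j < k" for j
      using free[of j] pow[of j] that hy xpoint by (cases "j = 0") auto
    have "(nxt D ^^ j) y \<noteq> x" if "0 < j" "j \<le> k" for j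
    proof
      assume *: "(nxt D ^^ j) y = x"
      obtain i where i: "j = Suc i" using \<open>0 < j\<close> by (cases j) auto
      then have "nxt D ((nxt D ^^ i) y) = nxt D h" using * adjacent by simp
      then have "(nxt D ^^ i) y = h" by (metis bow prv_nxt)
      then show False using noth[of i] i \<open>j \<le> k\<close> by simp
    qed note notx = this
    have free': "(nxt D ^^ j) y \<notin> xpoints D" if "0 < j" "j < k" for j
      using free[OF that] pow[of j] noth[of j] notx[of j] that by simp
    show ?thesis
    proof (cases "z = x")
      case True
      \<comment> \<open>The new place of \<open>x\<close> is the old place of \<open>h\<close>, so
        the old gap ending at \<open>x\<close> has length \<open>Suc k\<close>.\<close>
      then have zh: "(nxt D ^^ k) y = h"
        using pow[of k] by (auto simp: z_def transpose_def split: if_splits)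
      then have zx: "(nxt D ^^ Suc k) y = x" using adjacent by simp
      have "N_at D ((nxt D ^^ Suc k) y) < N_at D y + int (Suc k)"
      proof (rule balanceableD[OF D y'])
        show "(nxt D ^^ Suc k) y \<in> xpoints D" using zx xpoint by simp
        fix j assume "0 < j" "j < Suc k"
        then show "(nxt D ^^ j) y \<notin> xpoints D"
          using free'[of j] zh arrow_neq_xpoint by (cases "j = k") auto
      qed simp
      then show ?thesis
        unfolding zx using True N_at_swap_x N_at_swap_other[OF y' False] by simp
    next
      case zx: False
      then have zk: "(nxt D ^^ k) y = z"
        using pow[of k] hz by (auto simp: z_def transpose_def split: if_splits)
      have "N_at D ((nxt D ^^ k) y) < N_at D y + int k"
        by (rule balanceableD[OF D y' k _ free']) (simp_all add: zk z)
      then show ?thesis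
        using zk N_at_swap_other[OF y' False] N_at_swap_other[OF z zx] by simp
    qed
  qed
  then show "N_at D' ((nxt D' ^^ k) y) < N_at D' y + int k" by (simp add: z_def)
qed

lemma x_step_balanceable: "x_step x D E \<Longrightarrow> balanceable D \<Longrightarrow> balanceable E"
  by (auto simp: x_step_def hw_exchange.balanceable_swap)

lemma funpow_nxt_prv:
  assumes "bow_diagram D" "j \<le> k"
  shows "(nxt D ^^ j) ((prv D ^^ k) y) = (prv D ^^ (k - j)) y"
  using assms(2)
proof (induction j)
  case (Suc j)
  then have "k - j = Suc (k - Suc j)" by simp
  then show ?case using Suc by (simp add: assms(1))
qed simp

text \<open>Reversal swaps the two ends of each gap and negates \<open>N_at\<close>, so the two
  effects cancel.\<close>

lemma balanceable_mirror:
  assumes b: "bow_diagram D" and D: "balanceable D"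
  shows "balanceable (mirror D)"
proof (rule balanceableI)
  fix y k
  assume y: "y \<in> xpoints (mirror D)" and k: "0 < k"
    and z: "(nxt (mirror D) ^^ k) y \<in> xpoints (mirror D)"
    and free: "\<And>j. 0 < j \<Longrightarrow> j < k \<Longrightarrow> (nxt (mirror D) ^^ j) y \<notin> xpoints (mirror D)"
  define z where "z = (prv D ^^ k) y"
  have pow: "(nxt D ^^ j) z = (prv D ^^ (k - j)) y" if "j \<le> k" for j
    unfolding z_def using b that by (rule funpow_nxt_prv)
  have "N_at D ((nxt D ^^ k) z) < N_at D z + int k"
  proof (rule balanceableD[OF D _ k])
    show "(nxt D ^^ j) z \<notin> xpoints D" if "0 < j" "j < k" for j
      using free[of "k - j"] pow[of j] that by simp
  qed (use z y pow[of k] in \<open>simp_all add: z_def\<close>)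
  then show "N_at (mirror D) ((nxt (mirror D) ^^ k) y) < N_at (mirror D) y + int k"
    using pow[of k] by (simp add: N_at_mirror b z_def)
qed

section \<open>Lowering the positive values of \<open>N_at\<close>\<close>

lemma positive_x_step_exists:
  assumes b: "bow_diagram D" and D: "balanceable D" and h: "h \<in> arrows D"
    and x: "x \<in> xpoints D" "N_at D x > 0"
  obtains y E where "x_step y D E" "N_at D y > 0"
proof -
  \<comment> \<open>Induction on the number of steps from the arrow \<open>h\<close> to
    \<open>x\<close>: the backward walk from \<open>x\<close> meets an arrow at \<open>h\<close> at
    the latest.\<close>
  have ex: "\<exists>y E. x_step y D E \<and> N_at D y > 0"
    if "(nxt D ^^ k) h = x" "x \<in> xpoints D" "N_at D x > 0" for k x
    using that
  proof (induction k arbitrary: x)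
    case 0
    then show ?case using h bow_diagramD(3)[OF b] by auto
  next
    case (Suc k)
    define z where "z = (nxt D ^^ k) h"
    have zx: "nxt D z = x" using Suc.prems(1) by (simp add: z_def)
    have "z \<in> marked D"
      unfolding z_def by (rule cyclic_on_funpow_in[OF bow_diagramD(5)[OF b]])
        (simp add: h marked_def)
    then consider "z \<in> arrows D" | "z \<in> xpoints D" by (auto simp: marked_def)
    then show ?case
    proof cases
      case 1
      then have "hw_exchange D z x" using b zx Suc.prems(2) by unfold_locales
      then show ?thesis using Suc.prems(3) by (auto simp: x_step_def)
    next
      case 2
      \<comment> \<open>The gap has length 1 and contains no arrow, so positivity passes from
        \<open>x\<close> back to \<open>z\<close>.\<close>
      have "N_at D x < N_at D z + 1"
        using balanceableD[OF D 2, of 1] zx Suc.prems(2) by simp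
      then show ?thesis using Suc.IH[of z] 2 Suc.prems(3) by (simp add: z_def)
    qed
  qed
  have "x \<in> orbit (nxt D) h"
    using orbit_cyclic_eq3[OF bow_diagramD(5)[OF b]] h x by (simp add: marked_def)
  then obtain k where "(nxt D ^^ k) h = x" by (auto simp: orbit_altdef)
  then show ?thesis using ex x that by blast
qed

text \<open>Only points with positive \<open>N_at\<close> are moved, so the sum of the positive
  parts decreases and no nonnegative value turns negative. The latter keeps the zeros intact and
  makes a start with nonnegative values end in zeros.\<close>

lemma bow_steps_to_nonpos:
  assumes "bow_diagram D" "balanceable D" "arrows D \<noteq> {}"
  shows "\<exists>E. bow_step\<^sup>*\<^sup>* D E \<and> bow_diagram E \<and> balanceable E \<and>
    (\<forall>x\<in>xpoints D. N_at E x \<le> 0 \<and> (0 \<le> N_at D x \<longrightarrow> 0 \<le> N_at E x))"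
  using assms
proof (induction "\<Sum>x\<in>xpoints D. nat (N_at D x)" arbitrary: D rule: less_induct)
  case less
  show ?case
  proof (cases "\<exists>x\<in>xpoints D. N_at D x > 0")
    case False
    then show ?thesis using less.prems by (intro exI[of _ D]) auto
  next
    case True
    then obtain y E where y: "x_step y D E" "N_at D y > 0"
      using positive_x_step_exists less.prems by (metis ex_in_conv)
    note E = x_stepD[OF y(1)] x_step_N_at[OF y(1)]
    have "(\<Sum>x\<in>xpoints E. nat (N_at E x)) < (\<Sum>x\<in>xpoints D. nat (N_at D x))"
      unfolding E(5)
      by (rule sum_strict_mono_ex1)
        (use E y(2) bow_diagramD(2)[OF E(1)] in \<open>auto intro!: bexI[of _ y]\<close>)
    then obtain F where F: "bow_step\<^sup>*\<^sup>* E F" "bow_diagram F" "balanceable F"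
      "\<forall>x\<in>xpoints D. N_at F x \<le> 0 \<and> (0 \<le> N_at E x \<longrightarrow> 0 \<le> N_at F x)"
      using less.hyps[of E] E(2,4,5) x_step_balanceable[OF y(1)] less.prems by auto
    have "0 \<le> N_at E x" if "x \<in> xpoints D" "0 \<le> N_at D x" for x
      using E(8)[OF that(1)] that y(2) by auto
    then show ?thesis
      using F y(1) by (meson bow_step_def converse_rtranclp_into_rtranclp)
  qed
qed

section \<open>Existence and uniqueness of the cobalanced diagram\<close>

text \<open>Here \<open>bow_step\<close> includes well-formedness and \<open>hw_transition\<close>
  does not; the two closures agree because transitions from a bow diagram reach only bow
  diagrams.\<close>

lemma equivclp_bow_step_iff:
  assumes "bow_diagram D"
  shows "equivclp bow_step D E \<longleftrightarrow> hw_transition\<^sup>*\<^sup>* D E"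
proof
  show "hw_transition\<^sup>*\<^sup>* D E" if "equivclp bow_step D E"
    using that
    by (induction rule: equivclp_induct)
      (auto simp: bow_step_iff_hw_move hw_transition_def intro: rtranclp.rtrancl_into_rtrancl)
  have "equivclp bow_step D E \<and> bow_diagram E" if "hw_transition\<^sup>*\<^sup>* D E"
    using that
  proof (induction rule: rtranclp_induct)
    case (step E F)
    then have "bow_diagram F" "bow_step E F \<or> bow_step F E"
      using hw_move_bow_diagram_iff by (auto simp: hw_transition_def bow_step_iff_hw_move)
    then show ?case
      using step.IH by (auto intro: equivclp_into_equivclp)
  qed (simp add: assms)
  then show "equivclp bow_step D E" if "hw_transition\<^sup>*\<^sup>* D E" using that by blast
qed

lemma cobalanced_reachable:
  assumes D: "bow_diagram D" and bal: "balanceable D" and a: "arrows D \<noteq> {}"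
  shows "\<exists>E. hw_transition\<^sup>*\<^sup>* D E \<and> bow_diagram E \<and> cobalanced E"
proof -
  obtain E where E: "bow_step\<^sup>*\<^sup>* D E" "bow_diagram E" "balanceable E"
    "\<forall>x\<in>xpoints D. N_at E x \<le> 0"
    using bow_steps_to_nonpos[OF assms] by metis
  have DE: "xpoints E = xpoints D" "arrows E = arrows D"
    using bow_steps_mono[OF E(1)] by auto
  \<comment> \<open>All values at \<open>E\<close> are nonpositive, hence nonnegative in
    \<open>mirror E\<close>, and a second descent there brings them to 0.\<close>
  obtain F where F: "bow_step\<^sup>*\<^sup>* (mirror E) F" "bow_diagram F"
    "\<forall>x\<in>xpoints D. N_at F x \<le> 0 \<and> (N_at E x \<le> 0 \<longrightarrow> 0 \<le> N_at F x)"
    using bow_steps_to_nonpos[OF bow_diagram_mirror[OF E(2)] balanceable_mirror[OF E(2,3)]] a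
    by (auto simp: DE N_at_mirror E(2))
  have "xpoints F = xpoints D" using bow_steps_mono[OF F(1)] DE by simp
  then have "cobalanced (mirror F)"
    using F(3) E(4) by (force simp: cobalanced_def N_at_mirror F(2))
  \<comment> \<open>Read in the original orientation, the second descent consists of inverse moves
    from \<open>E\<close> to \<open>mirror F\<close>.\<close>
  moreover have "bow_step\<^sup>*\<^sup>* (mirror F) E"
    using bow_steps_mirror[OF F(1)] mirror_mirror[OF E(2)] by simp
  then have "equivclp bow_step D (mirror F)"
    using E(1) by (metis equivclp_sym equivclp_trans rtranclp_equivclp predicate2D rtranlcp_le_equivclp)
  ultimately show ?thesis
    using equivclp_bow_step_iff[OF D] bow_diagram_mirror[OF F(2)] by blast
qed

text \<open>Confluence supplies a common target \<open>E\<close>. Reversal makes it a common source,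
  where diagrams with equal \<open>N_at\<close> (here all zero) coincide.\<close>

lemma cobalanced_unique:
  assumes "equivclp bow_step A B" "bow_diagram A" "bow_diagram B" "cobalanced A" "cobalanced B"
  shows "A = B"
proof -
  obtain E where E: "bow_step\<^sup>*\<^sup>* A E" "bow_step\<^sup>*\<^sup>* B E"
    using assms(1)
    unfolding semiconfluentp_equivclp[OF confluentp_imp_semiconfluentp[OF confluentp_bow_step]]
    by (auto simp: rtranclp_conversep)
  have "mirror A = mirror B"
  proof (rule bow_steps_N_at_unique[OF bow_steps_mirror[OF E(1)] bow_steps_mirror[OF E(2)]])
    fix y assume "y \<in> xpoints (mirror E)"
    then show "N_at (mirror A) y = N_at (mirror B) y"
      using bow_steps_mono[OF E(1)] bow_steps_mono[OF E(2)] assms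
      by (simp add: N_at_mirror cobalanced_def)
  qed
  then show ?thesis
    using mirror_mirror assms(2,3) by metis
qed

section \<open>From the numbered \<open>x\<close>-points to the condition on gaps\<close>

lemma balanceable_if_N_between_nonneg:
  assumes D: "bow_diagram D" and x: "anticlockwise_numbering D n x"
    and N: "\<And>i. i < n \<Longrightarrow> N_between D (x i) (x (Suc i mod n)) \<ge> 0"
  shows "balanceable D"
proof (rule balanceableI)
  fix y k
  assume y: "y \<in> xpoints D" and k: "0 < k" and z: "(nxt D ^^ k) y \<in> xpoints D"
    and free: "\<And>j. 0 < j \<Longrightarrow> j < k \<Longrightarrow> (nxt D ^^ j) y \<notin> xpoints D"
  have img: "x ` {..<n} = xpoints D"
    using x by (simp add: anticlockwise_numbering_def bij_betw_def)
  have "y \<in> x ` {..<n}" using y by (simp only: img)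
  then obtain i where i: "i < n" "y = x i" by blast
  define b where "b = x (Suc i mod n)"
  have b: "b \<in> xpoints D"
    unfolding b_def img[symmetric] using i(1) by (intro imageI) simp
  have free_arc: "xpoints D \<inter> arc D y b = {}"
    using x i by (simp add: anticlockwise_numbering_def b_def)
  \<comment> \<open>The first \<open>x\<close>-point met after \<open>y\<close> must be
    \<open>b\<close>: otherwise it would lie in the arc from \<open>y\<close> to \<open>b\<close>,
    which contains no \<open>x\<close>-point.\<close>
  have zb: "(nxt D ^^ k) y = b"
  proof (rule ccontr)
    assume "(nxt D ^^ k) y \<noteq> b"
    then have "\<forall>j\<in>{1..k}. (nxt D ^^ j) y \<noteq> b"
      using free b by (metis atLeastAtMost_iff le_neq_implies_less less_eq_Suc_le One_nat_def)
    then have "(nxt D ^^ k) y \<in> arc D y b" using k by (auto simp: arc_def)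
    then show False using free_arc z by blast
  qed
  \<comment> \<open>An upper bound on the arrows suffices: at most \<open>k - 1\<close> points lie
    strictly between, which yields the strict inequality.\<close>
  have "arc D y b \<subseteq> (\<lambda>j. (nxt D ^^ j) y) ` {1..<k}"
  proof
    fix p assume "p \<in> arc D y b"
    then obtain j where j: "0 < j" "\<forall>i\<in>{1..j}. (nxt D ^^ i) y \<noteq> b" "p = (nxt D ^^ j) y"
      by (auto simp: arc_def)
    then have "j < k" using zb k by (force simp: not_less)
    then show "p \<in> (\<lambda>j. (nxt D ^^ j) y) ` {1..<k}" using j by auto
  qed
  then have "card (arrows D \<inter> arc D y b) \<le> card ((\<lambda>j. (nxt D ^^ j) y) ` {1..<k})"
    by (intro card_mono) auto
  also have "\<dots> \<le> k - 1"
    using card_image_le[of "{1..<k}" "\<lambda>j. (nxt D ^^ j) y"] by simp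
  finally have "int (card (arrows D \<inter> arc D y b)) < int k" using k by linarith
  then show "N_at D ((nxt D ^^ k) y) < N_at D y + int k"
    using N[OF i(1)] i(2) zb by (simp add: N_between_def b_def)
qed

theorem proposition7p20:
  fixes D :: "'p bow_diagram" and n :: nat and x :: "nat \<Rightarrow> 'p"
  assumes "bow_diagram D"
    and "nonneg_dims D"
    and "arrows D \<noteq> {}"
    and "n \<ge> 2"
    and "anticlockwise_numbering D n x"
    and "\<And>i. i < n \<Longrightarrow> N_between D (x i) (x (Suc i mod n)) \<ge> 0"
  shows "\<exists>!D'. hw_transition\<^sup>*\<^sup>* D D' \<and> bow_diagram D' \<and> cobalanced D'"
proof -
  have "balanceable D"
    using balanceable_if_N_between_nonneg assms by blast
  then have "\<exists>E. hw_transition\<^sup>*\<^sup>* D E \<and> bow_diagram E \<and> cobalanced E"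
    using cobalanced_reachable assms by blast
  moreover have "A = B"
    if "hw_transition\<^sup>*\<^sup>* D A \<and> bow_diagram A \<and> cobalanced A"
      "hw_transition\<^sup>*\<^sup>* D B \<and> bow_diagram B \<and> cobalanced B" for A B
  proof -
    have "equivclp bow_step A B"
      using that equivclp_bow_step_iff[OF assms(1)] by (meson equivclp_sym equivclp_trans)
    then show ?thesis using cobalanced_unique that by blast
  qed
  ultimately show ?thesis by blast
qed

end
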